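(* $\mathbf{GR}^\circ$ is a conservative extension of $\mathbf{N}$: for every $\mathcal{L}_\blacksquare$-formula $A$, if $\mathbf{GR}^\circ\vdash A$, then $\mathbf{N}\vdash A$.
   Context: $\mathcal{L}_2$ is the bimodal propositional language with countably many propositional variables, $\bot$, connectives $\neg,\vee$ (others defined), and unary modal operators $\Box,\blacksquare$; $\Diamond$ abbreviates $\neg\Box\neg$. $\mathcal{L}_\blacksquare$ is the $\blacksquare$-fragment of $\mathcal{L}_2$ (formulas without $\Box$). The logic $\mathbf{N}$ in $\mathcal{L}_\blacksquare$ has as axioms all propositional tautologies of $\mathcal{L}_\blacksquare$ and as rules modus ponens and $\blacksquare$-necessitation (from $A$ infer $\blacksquare A$). The logic $\mathbf{GR}^-$ has as axioms all propositional tautologies of $\mathcal{L}_2$ and all instances of $\Box(A\to B)\to(\Box A\to\Box B)$, $\Box(\Box A\to A)\to\Box A$, $\blacksquare A\to\Box A$, $\Box A\to\Box\blacksquare A$, $\Box A\to(\Box\bot\vee\blacksquare A)$, $\Diamond\blacksquare A\to\Diamond A$, and rules modus ponens and $\Box$-necessitation. $\mathbf{GR}^\circ$ is $\mathbf{GR}^-$ plus the rule: from $A$ infer $\blacksquare A$. *)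

theory Defs
  imports Main
begin

datatype fm =
    Var nat
  | Bot
  | Neg fm
  | Or fm fm
  | Box fm
  | BBox fm

abbreviation Imp :: "fm \<Rightarrow> fm \<Rightarrow> fm" where
  "Imp A B \<equiv> Or (Neg A) B"

abbreviation Dia :: "fm \<Rightarrow> fm" where
  "Dia A \<equiv> Neg (Box (Neg A))"

text \<open>Membership in the black-box fragment: no occurrence of \<^const>\<open>Box\<close>.\<close>

fun bb_fm :: "fm \<Rightarrow> bool" where
  "bb_fm (Var p) \<longleftrightarrow> True"
| "bb_fm Bot \<longleftrightarrow> True"
| "bb_fm (Neg A) \<longleftrightarrow> bb_fm A"
| "bb_fm (Or A B) \<longleftrightarrow> bb_fm A \<and> bb_fm B"
| "bb_fm (Box A) \<longleftrightarrow> False"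
| "bb_fm (BBox A) \<longleftrightarrow> bb_fm A"

text \<open>Propositional evaluation: variables and formulas whose outermost operator is modal are
  the atoms, and \<open>v\<close> assigns each of them an arbitrary truth value. The values of \<open>v\<close> on other
  formulas are irrelevant.\<close>

fun prop_eval :: "(fm \<Rightarrow> bool) \<Rightarrow> fm \<Rightarrow> bool" where
  "prop_eval v (Var p) \<longleftrightarrow> v (Var p)"
| "prop_eval v Bot \<longleftrightarrow> False"
| "prop_eval v (Neg A) \<longleftrightarrow> \<not> prop_eval v A"
| "prop_eval v (Or A B) \<longleftrightarrow> prop_eval v A \<or> prop_eval v B"
| "prop_eval v (Box A) \<longleftrightarrow> v (Box A)"
| "prop_eval v (BBox A) \<longleftrightarrow> v (BBox A)"

definition tautology :: "fm \<Rightarrow> bool" where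
  "tautology A \<longleftrightarrow> (\<forall>v. prop_eval v A)"

text \<open>Derivability in \<open>N\<close>. All formulas in a derivation lie in the black-box fragment: the axioms
  do, and both rules preserve this.\<close>

inductive N_proves :: "fm \<Rightarrow> bool" where
  N_taut: "bb_fm A \<Longrightarrow> tautology A \<Longrightarrow> N_proves A"
| N_mp: "N_proves (Imp A B) \<Longrightarrow> N_proves A \<Longrightarrow> N_proves B"
| N_bnec: "N_proves A \<Longrightarrow> N_proves (BBox A)"

inductive GR_axiom :: "fm \<Rightarrow> bool" where
  "tautology A \<Longrightarrow> GR_axiom A"
| "GR_axiom (Imp (Box (Imp A B)) (Imp (Box A) (Box B)))"
| "GR_axiom (Imp (Box (Imp (Box A) A)) (Box A))"
| "GR_axiom (Imp (BBox A) (Box A))"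
| "GR_axiom (Imp (Box A) (Box (BBox A)))"
| "GR_axiom (Imp (Box A) (Or (Box Bot) (BBox A)))"
| "GR_axiom (Imp (Dia (BBox A)) (Dia A))"

text \<open>Derivability in \<open>GR\<^sup>\<circ>\<close>; dropping the last rule gives \<open>GR\<^sup>-\<close>.\<close>

inductive GRcirc_proves :: "fm \<Rightarrow> bool" where
  GR_ax: "GR_axiom A \<Longrightarrow> GRcirc_proves A"
| GR_mp: "GRcirc_proves (Imp A B) \<Longrightarrow> GRcirc_proves A \<Longrightarrow> GRcirc_proves B"
| GR_nec: "GRcirc_proves A \<Longrightarrow> GRcirc_proves (Box A)"
| GR_bnec: "GRcirc_proves A \<Longrightarrow> GRcirc_proves (BBox A)"

end

theory Submission imports Defs begin

text \<open>Replacing every subformula \<open>Box B\<close> by a truth constant turns each axiom of \<open>GR\<^sup>\<circ>\<close> into a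
  tautology of the black-box fragment (in particular \<open>Dia A\<close> becomes false and \<open>Box Bot\<close> true),
  turns the rules into admissible rules of \<open>N\<close>, and fixes the formulas of that fragment.\<close>

fun erase_box :: "fm \<Rightarrow> fm" where
  "erase_box (Var p) = Var p"
| "erase_box Bot = Bot"
| "erase_box (Neg A) = Neg (erase_box A)"
| "erase_box (Or A B) = Or (erase_box A) (erase_box B)"
| "erase_box (Box A) = Neg Bot"
| "erase_box (BBox A) = BBox (erase_box A)"

lemma bb_fm_erase_box: "bb_fm (erase_box A)"
  by (induction A) auto

lemma erase_box_bb_fm: "bb_fm A \<Longrightarrow> erase_box A = A"
  by (induction A) auto

text \<open>Modal formulas are atoms for \<open>prop_eval\<close>, so erasing acts as a substitution
  for atoms: the new valuation gives each atom the value of its erasure.\<close>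

lemma prop_eval_erase_box:
  "prop_eval v (erase_box A) \<longleftrightarrow> prop_eval (\<lambda>B. prop_eval v (erase_box B)) A"
  by (induction A) auto

lemma tautology_erase_box: "tautology A \<Longrightarrow> tautology (erase_box A)"
  unfolding tautology_def using prop_eval_erase_box by blast

lemma GR_axiom_tautology_erase_box: "GR_axiom A \<Longrightarrow> tautology (erase_box A)"
  \<comment> \<open>Each erased modal axiom has a true consequent or, for the \<open>Dia\<close>
    axiom, a false antecedent.\<close>
  by (induction rule: GR_axiom.induct) (simp add: tautology_erase_box, simp_all add: tautology_def)

lemma GRcirc_proves_imp_N_proves_erase_box: "GRcirc_proves A \<Longrightarrow> N_proves (erase_box A)"
proof (induction rule: GRcirc_proves.induct)
  case (GR_ax A)
  then show ?case
    by (intro N_taut bb_fm_erase_box GR_axiom_tautology_erase_box)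
next
  case (GR_mp A B)
  then show ?case
    using N_mp by simp
next
  case (GR_nec A)
  \<comment> \<open>\<open>Box A\<close> erases to \<open>Neg Bot\<close>, itself an axiom of
    \<open>N\<close>.\<close>
  show ?case
    by (simp add: N_taut tautology_def)
next
  case (GR_bnec A)
  then show ?case
    by (simp add: N_bnec)
qed

text \<open>The extension half: axioms and rules of \<open>N\<close> are among those of the larger
  logic.\<close>

lemma N_proves_imp_GRcirc_proves: "N_proves A \<Longrightarrow> GRcirc_proves A"
  by (induction rule: N_proves.induct) (auto intro: GRcirc_proves.intros GR_axiom.intros(1))

theorem theorem3p6:
  shows "(\<forall>A. N_proves A \<longrightarrow> GRcirc_proves A) \<and>
         (\<forall>A. bb_fm A \<longrightarrow> GRcirc_proves A \<longrightarrow> N_proves A)"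
  using N_proves_imp_GRcirc_proves GRcirc_proves_imp_N_proves_erase_box erase_box_bb_fm
  by fastforce

end
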